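(* Let $a,b,m\in\mathbb{Z}$ with $a\ge 2$, $m>1$, $\gcd(b,m)=1$, and $b\ge -(a-2)m-2$, and let $S=S_{a,b}(m)$ and $d=(a-1)m+b$. Let $n$ be the smallest positive integer such that $A_n\ge m$, let $A=\{A_1,\ldots,A_{n-1}\}$, and for $0\le\ell\le m-1$ set $W(\ell)=d\ell+\mathsf{m}_A(\ell)m$ and $r(\ell)=\sum_{i=1}^{n-2}u_i^{(\ell)}A_i$. For $\ell\in\{0,\ldots,m-1\}$, if $W(\ell)\in\operatorname{Maximals}_{\preceq_S}(\operatorname{Ap}(S))$, then exactly one of the following conditions holds: (I) $u_{n-1}^{(\ell)}=u_{n-1}^{(m-1)}$ and $r(\ell)\le r(m-1)$; (II) $u_{n-1}^{(\ell)}=u_{n-1}^{(m-1)}-1$ and $r(\ell)\ge r(m-1)+1$.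
   Context: $\mathbb{N}=\{0,1,2,\dots\}$. Let $T_{a,b}(z)=az+b$, with $T_{a,b}^i$ its $i$-fold composition ($T_{a,b}^0$ the identity), and let $S_{a,b}(m)=\langle T_{a,b}^i(m)\mid i\ge 0\rangle$ be the submonoid of $(\mathbb{N},+)$ generated by the orbit of $m$; under the stated hypotheses it is a numerical semigroup (finite complement in $\mathbb{N}$) whose smallest positive element is $m$. Set $A_i=(a^i-1)/(a-1)$ for $i\ge 0$ (so $A_1=1$); since $m>1$, $n\ge 2$. The Apéry set is $\operatorname{Ap}(S)=\{s\in S\mid s-m\notin S\}$; under the stated hypotheses $\operatorname{Ap}(S)=\{W(0),\ldots,W(m-1)\}$. The order $\preceq_S$ is $x\preceq_S y$ iff $y-x\in S$, and $\operatorname{Maximals}_{\preceq_S}(\operatorname{Ap}(S))$ is the set of maximal elements of $\operatorname{Ap}(S)$ for $\preceq_S$. $\mathsf{m}_A(x)$ is the minimum of $\sum_{i=1}^{n-1}u_i$ over all $(u_1,\ldots,u_{n-1})\in\mathbb{N}^{n-1}$ with $x=\sum_{i=1}^{n-1}u_iA_i$. $R(a,n)$ is the set of $\mathbf{u}=(u_1,\ldots,u_{n-1})\in\mathbb{N}^{n-1}$ such that $0\le u_j\le a$ for all $j$, and if $u_j=a$ then $u_k=0$ for every $k<j$. For each integer $0\le\ell<A_n$ there is a unique $\mathbf{u}^{(\ell)}=(u^{(\ell)}_1,\ldots,u^{(\ell)}_{n-1})\in R(a,n)$ with $\ell=\sum_{i=1}^{n-1}u^{(\ell)}_iA_i$,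 called the canonical representative of $\ell$. Thus $\ell=u_{n-1}^{(\ell)}A_{n-1}+r(\ell)$ (empty sums are $0$). *)

theory Defs
  imports Main
begin

inductive_set submonoid_generated :: "'a::monoid_add set \<Rightarrow> 'a set" for X where
  zero: "0 \<in> submonoid_generated X"
| gen: "x \<in> X \<Longrightarrow> x \<in> submonoid_generated X"
| add: "x \<in> submonoid_generated X \<Longrightarrow> y \<in> submonoid_generated X \<Longrightarrow> x + y \<in> submonoid_generated X"

definition affine_map :: "int \<Rightarrow> int \<Rightarrow> int \<Rightarrow> int" where
  "affine_map a b z = a * z + b"

(* Subsets of the naturals are represented as sets of integers, because b may be negative and
   because the Apery set and the order below use integer differences. If a \<ge> 2, m > 1,
   gcd b m = 1 and b \<ge> -(a - 2) * m - 2, then (a - 1) * m + b > 0, so the orbit of m is increasing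
   and the monoid generated in the integers is a submonoid of the naturals. *)
definition orbit_semigroup :: "int \<Rightarrow> int \<Rightarrow> int \<Rightarrow> int set" where
  "orbit_semigroup a b m = submonoid_generated (range (\<lambda>i::nat. (affine_map a b ^^ i) m))"

definition apery_set :: "int set \<Rightarrow> int \<Rightarrow> int set" where
  "apery_set S m = {s \<in> S. s - m \<notin> S}"

definition semigroup_le :: "int set \<Rightarrow> int \<Rightarrow> int \<Rightarrow> bool" where
  "semigroup_le S x y \<longleftrightarrow> y - x \<in> S"

definition maximals :: "('a \<Rightarrow> 'a \<Rightarrow> bool) \<Rightarrow> 'a set \<Rightarrow> 'a set" where
  "maximals le X = {x \<in> X. \<forall>y \<in> X. le x y \<longrightarrow> y = x}"

(* The number A_i; the division is exact for a \<ge> 2. *)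
definition repunit :: "int \<Rightarrow> nat \<Rightarrow> int" where
  "repunit a i = (a ^ i - 1) div (a - 1)"

(* Tuples (u_1, ..., u_(n-1)) are functions on nat, read on the index set {1..<n}. *)
definition repunit_value :: "int \<Rightarrow> nat \<Rightarrow> (nat \<Rightarrow> nat) \<Rightarrow> int" where
  "repunit_value a n u = (\<Sum>i\<in>{1..<n}. int (u i) * repunit a i)"

(* The minimum m_A(x) for A = {A_1, ..., A_(n-1)}; it exists if x \<ge> 0 and n \<ge> 2, as A_1 = 1. *)
definition min_length :: "int \<Rightarrow> nat \<Rightarrow> int \<Rightarrow> nat" where
  "min_length a n x =
     (LEAST k. \<exists>u :: nat \<Rightarrow> nat. x = repunit_value a n u \<and> k = (\<Sum>i\<in>{1..<n}. u i))"

(* The set R(a,n). Entries outside {1..<n} are 0, so that a tuple corresponds to one function. *)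
definition canonical_tuples :: "int \<Rightarrow> nat \<Rightarrow> (nat \<Rightarrow> nat) set" where
  "canonical_tuples a n =
     {u. (\<forall>j. j \<notin> {1..<n} \<longrightarrow> u j = 0) \<and>
         (\<forall>j\<in>{1..<n}. int (u j) \<le> a \<and> (int (u j) = a \<longrightarrow> (\<forall>k\<in>{1..<j}. u k = 0)))}"

(* Meaningful for 0 \<le> l < A_n, where existence and uniqueness hold. *)
definition canonical_rep :: "int \<Rightarrow> nat \<Rightarrow> int \<Rightarrow> nat \<Rightarrow> nat" where
  "canonical_rep a n l = (THE u. u \<in> canonical_tuples a n \<and> l = repunit_value a n u)"

end

theory Submission
  imports Defs
begin

text \<open>
  Every generator of the semigroup is \<open>m + d A\<^sub>i\<close>, so its elements are the numbers \<open>k m + d x\<close>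
  where \<open>x\<close> is a sum of at most \<open>k\<close> repunits. The exchange \<open>a A\<^sub>j + A\<^sub>i = A\<^sub>j\<^sub>+\<^sub>1 + a A\<^sub>i\<^sub>-\<^sub>1\<close> does not
  lengthen a sum and shows that any number at least \<open>A\<^sub>n\<^sub>-\<^sub>1\<close> has a shortest representation
  using \<open>A\<^sub>n\<^sub>-\<^sub>1\<close>. Hence if \<open>l + A\<^sub>n\<^sub>-\<^sub>1 < m\<close>, then \<open>W (l + A\<^sub>n\<^sub>-\<^sub>1) - W l = m + d A\<^sub>n\<^sub>-\<^sub>1\<close> lies in \<open>S\<close>
  and \<open>W l\<close> is not maximal; here \<open>W (l + A\<^sub>n\<^sub>-\<^sub>1)\<close> is in the Apery set because \<open>d \<ge> m - 2\<close>. Since the canonical top digit of \<open>l\<close> is \<open>l div A\<^sub>n\<^sub>-\<^sub>1\<close> and \<open>r l\<close> is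
  \<open>l mod A\<^sub>n\<^sub>-\<^sub>1\<close>, the remaining case \<open>l + A\<^sub>n\<^sub>-\<^sub>1 \<ge> m\<close> is exactly the disjunction of the two conditions.
\<close>

section \<open>Arithmetic of repunits\<close>

lemma repunit_mult:
  assumes "a \<ge> 2"
  shows "(a - 1) * repunit a i = a ^ i - 1"
proof -
  have "(a - 1) dvd a ^ i - 1"
    by (simp add: power_diff_1_eq)
  then show ?thesis by (simp add: repunit_def)
qed

lemma repunit_0 [simp]: "repunit a 0 = 0"
  by (simp add: repunit_def)

lemma repunit_Suc:
  assumes "a \<ge> 2"
  shows "repunit a (Suc i) = a * repunit a i + 1"
proof -
  have "(a - 1) * repunit a (Suc i) = (a - 1) * (a * repunit a i + 1)"
    using repunit_mult[OF assms, of i] repunit_mult[OF assms, of "Suc i"]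
    by (simp add: algebra_simps)
  then show ?thesis using assms by simp
qed

lemma repunit_1: "a \<ge> 2 \<Longrightarrow> repunit a (Suc 0) = 1"
  by (simp add: repunit_Suc)

text \<open>This crude linear growth gives positivity for positive indices and an index whose
  repunit is at least \<open>m\<close>.\<close>

lemma repunit_ge:
  assumes "a \<ge> 2"
  shows "int i \<le> repunit a i"
proof (induction i)
  case (Suc i)
  have "1 * repunit a i \<le> a * repunit a i"
    using assms Suc by (intro mult_right_mono) auto
  then show ?case using Suc assms by (simp add: repunit_Suc)
qed simp

lemma repunit_nonneg: "a \<ge> 2 \<Longrightarrow> 0 \<le> repunit a i"
  using repunit_ge[of a i] by linarith

lemma repunit_mono:
  assumes "a \<ge> 2" "i \<le> j"
  shows "repunit a i \<le> repunit a j"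
  using assms(2)
proof (rule lift_Suc_mono_le[rotated])
  fix k
  have "1 * repunit a k \<le> a * repunit a k"
    using assms repunit_nonneg[of a k] by (intro mult_right_mono) auto
  then show "repunit a k \<le> repunit a (Suc k)"
    using assms by (simp add: repunit_Suc)
qed

subsection \<open>Sums of repunits\<close>

text \<open>Since \<open>A\<^sub>0 = 0\<close>, allowing the index \<open>0\<close> turns ``exactly \<open>k\<close> summands'' into ``at most \<open>k\<close>''.\<close>

inductive repunit_sum :: "int \<Rightarrow> nat set \<Rightarrow> int \<Rightarrow> nat \<Rightarrow> bool" for a I where
  zero: "repunit_sum a I 0 k"
| step: "repunit_sum a I x k \<Longrightarrow> i \<in> I \<Longrightarrow> repunit_sum a I (x + repunit a i) (Suc k)"

lemma repunit_sum_nonneg: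
  "repunit_sum a I x k \<Longrightarrow> a \<ge> 2 \<Longrightarrow> 0 \<le> x"
  by (induction rule: repunit_sum.induct) (auto simp: repunit_nonneg)

lemma repunit_sum_Suc: "repunit_sum a I x k \<Longrightarrow> repunit_sum a I x (Suc k)"
  by (induction rule: repunit_sum.induct) (auto intro: repunit_sum.intros)

lemma repunit_sum_mono: "repunit_sum a I x k \<Longrightarrow> k \<le> k' \<Longrightarrow> repunit_sum a I x k'"
  by (induction k' rule: nat_induct) (auto simp: le_Suc_eq intro: repunit_sum_Suc)

lemma repunit_sum_add:
  assumes "repunit_sum a I x k" "repunit_sum a I y k'"
  shows "repunit_sum a I (x + y) (k + k')"
  using assms(1)
proof (induction rule: repunit_sum.induct)
  case (zero k)
  show ?case using repunit_sum_mono[OF assms(2), of "k + k'"] by simp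
next
  case (step x k i)
  from repunit_sum.step[OF step.IH step.hyps(2)] show ?case by (simp add: algebra_simps)
qed

lemma repunit_sum_multiple:
  "i \<in> I \<Longrightarrow> repunit_sum a I (int k * repunit a i) k"
proof (induction k)
  case (Suc k)
  from repunit_sum.step[OF Suc.IH[OF Suc.prems] Suc.prems] show ?case
    by (simp add: algebra_simps)
qed (simp add: repunit_sum.zero)

lemma repunit_sum_subset:
  "repunit_sum a I x k \<Longrightarrow> I \<subseteq> J \<Longrightarrow> repunit_sum a J x k"
  by (induction rule: repunit_sum.induct) (auto intro: repunit_sum.intros)

text \<open>Summands are nonnegative and repunits are monotone, so one summand of index at least
  \<open>n\<close> would already reach \<open>repunit a n\<close>. This links semigroup elements,
  whose indices are unbounded, to \<open>min_length\<close>, whose indices are below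
  \<open>n\<close>.\<close>

lemma repunit_sum_restrict:
  assumes "repunit_sum a UNIV x k" "a \<ge> 2" "x < repunit a n"
  shows "repunit_sum a {..<n} x k"
  using assms(1,3)
proof (induction rule: repunit_sum.induct)
  case (step x k i)
  have "0 \<le> x" using step assms(2) repunit_sum_nonneg by blast
  have "\<not> n \<le> i" using repunit_mono[OF assms(2), of n i] step \<open>0 \<le> x\<close> by auto
  then show ?case using step repunit_nonneg[OF assms(2), of i] by (auto intro: repunit_sum.step)
qed (rule repunit_sum.zero)

text \<open>Summands of index 0 contribute nothing, so a positive sum must contain a nonzero one.
  Index-0 summands passed over in the search remain as slack in the length.\<close>

lemma repunit_sum_pos_split:
  assumes "repunit_sum a I x k" "x > 0"
  obtains i k' where "Suc i \<in> I" "k = Suc k'" "repunit_sum a I (x - repunit a (Suc i)) k'"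
proof -
  have "\<exists>i k'. Suc i \<in> I \<and> k = Suc k' \<and> repunit_sum a I (x - repunit a (Suc i)) k'"
    using assms
  proof (induction rule: repunit_sum.induct)
    case (step x k i)
    show ?case
    proof (cases i)
      case 0
      then obtain i' k' where "Suc i' \<in> I" "k = Suc k'" "repunit_sum a I (x - repunit a (Suc i')) k'"
        using step by auto
      then show ?thesis using 0 repunit_sum_Suc by auto
    qed (use step in auto)
  qed simp
  then show thesis using that by blast
qed

lemma repunit_sum_top_split:
  assumes "repunit_sum a {..Suc j} x k"
  shows "repunit_sum a {..j} x k \<or>
         (\<exists>k'. k = Suc k' \<and> repunit_sum a {..Suc j} (x - repunit a (Suc j)) k')"
  using assms
proof (induction rule: repunit_sum.induct)
  case (step x k i)
  show ?case
  proof (cases "i = Suc j")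
    case False
    then have i: "i \<in> {..j}" using step by auto
    show ?thesis
      using step.IH
    proof (elim disjE exE conjE)
      fix k' assume "k = Suc k'" "repunit_sum a {..Suc j} (x - repunit a (Suc j)) k'"
      then show ?thesis
        using repunit_sum.step[of a "{..Suc j}" "x - repunit a (Suc j)" k' i] i
        by (auto simp: algebra_simps)
    qed (use i in \<open>auto intro: repunit_sum.step\<close>)
  qed (use step in auto)
qed (auto intro: repunit_sum.zero)

text \<open>Induction on the top index. If the top repunit does not occur in the sum, the exchange
  identity creates it: a copies of the next lower repunit and one further nonzero summand are traded
  for the top one and a smaller repunits, a + 1 summands on either side.\<close>

lemma repunit_sum_remove_top:
  assumes "a \<ge> 2"
  shows "repunit_sum a {..Suc j} x k \<Longrightarrow> repunit a (Suc j) \<le> x \<Longrightarrow>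
         \<exists>k'. k = Suc k' \<and> repunit_sum a {..Suc j} (x - repunit a (Suc j)) k'"
proof (induction j arbitrary: x k)
  case 0
  then have "x > 0" using repunit_1[OF assms] by simp
  from repunit_sum_pos_split[OF 0(1) this] show ?case by auto
next
  case (Suc j)
  note IH = Suc.IH
  from repunit_sum_top_split[OF Suc.prems(1)] show ?case
  proof
    assume x: "repunit_sum a {..Suc j} x k"
    \<comment> \<open>The outer induction hypothesis removes one copy at a time. Since x is at least
      a times the removed repunit plus 1, each of the first a removals still finds enough
      left.\<close>
    have strip: "\<exists>k'. k = i + k' \<and> repunit_sum a {..Suc j} (x - int i * repunit a (Suc j)) k'"
      if "int i \<le> a" for i
      using that
    proof (induction i)
      case (Suc i)
      then obtain k' where k': "k = i + k'"
        "repunit_sum a {..Suc j} (x - int i * repunit a (Suc j)) k'" by auto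
      have "(int i + 1) * repunit a (Suc j) \<le> a * repunit a (Suc j)"
        using Suc.prems repunit_nonneg[OF assms] by (intro mult_right_mono) auto
      then have "repunit a (Suc j) \<le> x - int i * repunit a (Suc j)"
        using \<open>repunit a (Suc (Suc j)) \<le> x\<close> repunit_Suc[OF assms, of "Suc j"]
        by (simp add: algebra_simps)
      from IH[OF k'(2) this] k'(1) show ?case
        by (auto simp: algebra_simps)
    qed (use x in simp)
    obtain k' where k': "k = nat a + k'"
      "repunit_sum a {..Suc j} (x - a * repunit a (Suc j)) k'"
      using strip[of "nat a"] assms by auto
    \<comment> \<open>The +1 in the recursion for repunits keeps the remainder positive, which
      supplies the extra summand needed for the exchange.\<close>
    have "x - a * repunit a (Suc j) > 0"
      using Suc.prems(2) repunit_Suc[OF assms, of "Suc j"] by simp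
    from repunit_sum_pos_split[OF k'(2) this] obtain i k'' where i: "Suc i \<in> {..Suc j}"
      "k' = Suc k''" "repunit_sum a {..Suc j} (x - a * repunit a (Suc j) - repunit a (Suc i)) k''" .
    \<comment> \<open>Removing \<open>repunit a (Suc i)\<close> and putting back a copies of
      \<open>repunit a i\<close> subtracts exactly 1, completing the top repunit. If i = 0, the
      copies are empty summands.\<close>
    have "repunit_sum a {..Suc j} (int (nat a) * repunit a i) (nat a)"
      using i(1) by (intro repunit_sum_multiple) auto
    from repunit_sum_add[OF i(3) this]
    have "repunit_sum a {..Suc j} (x - repunit a (Suc (Suc j))) (k'' + nat a)"
      using assms by (simp add: repunit_Suc algebra_simps)
    from repunit_sum_subset[OF this, of "{..Suc (Suc j)}"] show ?thesis
      using k'(1) i(2) by (auto simp: add.commute)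
  qed
qed

subsection \<open>Minimal lengths\<close>

lemma repunit_sum_of_tuple:
  "repunit_sum a {..<n} (repunit_value a n u) (\<Sum>i\<in>{1..<n}. u i)"
proof -
  have "repunit_sum a {..<n} (\<Sum>i\<in>J. int (u i) * repunit a i) (\<Sum>i\<in>J. u i)"
    if "finite J" "J \<subseteq> {..<n}" for J
    using that
    by (induction) (auto intro!: repunit_sum_add repunit_sum_multiple repunit_sum.zero)
  moreover have "{1..<n} \<subseteq> {..<n}" by auto
  ultimately show ?thesis unfolding repunit_value_def by blast
qed

text \<open>Only an inequality of lengths survives, because index-0 summands and slack have no
  counterpart in a tuple. This is enough for bounding a minimum.\<close>

lemma tuple_of_repunit_sum:
  assumes "repunit_sum a {..<n} x k"
  shows "\<exists>u. x = repunit_value a n u \<and> (\<Sum>i\<in>{1..<n}. u i) \<le> k"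
  using assms
proof (induction rule: repunit_sum.induct)
  case (zero k)
  show ?case by (rule exI[of _ "\<lambda>_. 0"]) (simp add: repunit_value_def)
next
  case (step x k i)
  then obtain u where u: "x = repunit_value a n u" "(\<Sum>i\<in>{1..<n}. u i) \<le> k" by blast
  show ?case
  proof (cases "i = 0")
    case True
    then show ?thesis using u by (auto intro!: exI[of _ u])
  next
    case False
    let ?v = "\<lambda>j. u j + (if j = i then 1 else 0)"
    have i: "i \<in> {1..<n}" using False step by auto
    have "repunit_value a n ?v = repunit_value a n u + repunit a i"
      using i by (simp add: repunit_value_def distrib_right sum.distrib if_distrib[of int]
          if_distrib[of "\<lambda>c. c * _"] cong: if_cong)
    moreover have "(\<Sum>j\<in>{1..<n}. ?v j) = (\<Sum>j\<in>{1..<n}. u j) + 1"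
      using i by (simp add: sum.distrib)
    ultimately show ?thesis using u by (intro exI[of _ ?v]) simp
  qed
qed

lemma min_length_le:
  assumes "repunit_sum a {..<n} x k"
  shows "min_length a n x \<le> k"
proof -
  obtain u where u: "x = repunit_value a n u" "(\<Sum>i\<in>{1..<n}. u i) \<le> k"
    using tuple_of_repunit_sum[OF assms] by blast
  have "min_length a n x \<le> (\<Sum>i\<in>{1..<n}. u i)"
    unfolding min_length_def using u(1) by (intro Least_le) blast
  then show ?thesis using u(2) by simp
qed

lemma repunit_sum_nat:
  assumes "a \<ge> 2" "n \<ge> 2" "x \<ge> 0"
  shows "repunit_sum a {..<n} x (nat x)"
  using repunit_sum_multiple[of 1 "{..<n}" a "nat x"] assms by (simp add: repunit_1)

lemma repunit_sum_min_length:
  assumes "a \<ge> 2" "n \<ge> 2" "x \<ge> 0"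
  shows "repunit_sum a {..<n} x (min_length a n x)"
proof -
  obtain u0 where "x = repunit_value a n u0"
    using tuple_of_repunit_sum[OF repunit_sum_nat[OF assms]] by blast
  then have "\<exists>k. \<exists>u :: nat \<Rightarrow> nat. x = repunit_value a n u \<and> k = (\<Sum>i\<in>{1..<n}. u i)" by blast
  from LeastI_ex[OF this] obtain u where "x = repunit_value a n u"
    "min_length a n x = (\<Sum>i\<in>{1..<n}. u i)" unfolding min_length_def by blast
  then show ?thesis using repunit_sum_of_tuple[of a n u] by simp
qed

text \<open>Appending the top repunit gives one inequality, and
  \<open>repunit_sum_remove_top\<close> applied to a shortest sum gives the other. Equality is what
  makes the difference of two values of \<open>W\<close> a single generator.\<close>

lemma min_length_add_top:
  assumes "a \<ge> 2" "x \<ge> 0"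
  shows "min_length a (Suc (Suc j)) (x + repunit a (Suc j)) = Suc (min_length a (Suc (Suc j)) x)"
proof (rule antisym)
  let ?n = "Suc (Suc j)"
  have n: "?n \<ge> 2" by simp
  show "min_length a ?n (x + repunit a (Suc j)) \<le> Suc (min_length a ?n x)"
    by (rule min_length_le, rule repunit_sum.step, rule repunit_sum_min_length[OF assms(1) n assms(2)])
      simp
  have "repunit_sum a {..Suc j} (x + repunit a (Suc j)) (min_length a ?n (x + repunit a (Suc j)))"
    using repunit_sum_min_length[OF assms(1) n, of "x + repunit a (Suc j)"] assms repunit_nonneg[of a "Suc j"]
    by (simp add: lessThan_Suc_atMost)
  from repunit_sum_remove_top[OF assms(1) this] assms obtain k' where
    "min_length a ?n (x + repunit a (Suc j)) = Suc k'" "repunit_sum a {..Suc j} x k'"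
    by auto
  then show "Suc (min_length a ?n x) \<le> min_length a ?n (x + repunit a (Suc j))"
    using min_length_le[of a ?n x k'] by (simp add: lessThan_Suc_atMost)
qed

subsection \<open>Canonical representatives\<close>

lemma repunit_value_Suc:
  "n \<ge> 1 \<Longrightarrow> repunit_value a (Suc n) u = repunit_value a n u + int (u n) * repunit a n"
  by (simp add: repunit_value_def atLeastLessThanSuc)

lemma repunit_value_upd: "repunit_value a n (u(n := c)) = repunit_value a n u"
  by (auto simp: repunit_value_def intro!: sum.cong)

lemma canonical_tuples_truncate:
  "u \<in> canonical_tuples a (Suc n) \<Longrightarrow> u(n := 0) \<in> canonical_tuples a n"
  by (auto simp: canonical_tuples_def)

lemma canonical_tuples_top:
  assumes "u \<in> canonical_tuples a (Suc n)" "n \<ge> 1"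
  shows "int (u n) \<le> a" "int (u n) = a \<Longrightarrow> repunit_value a n u = 0"
  using assms by (auto simp: canonical_tuples_def repunit_value_def)

text \<open>A top digit below a leaves room for the lower part, which is smaller than the top
  repunit by induction. A top digit a forces the lower part to vanish, and the value is then the
  largest one allowed.\<close>

lemma repunit_value_canonical_bounds:
  assumes "a \<ge> 2"
  shows "u \<in> canonical_tuples a (Suc n) \<Longrightarrow>
         0 \<le> repunit_value a (Suc n) u \<and> repunit_value a (Suc n) u < repunit a (Suc n)"
proof (induction n arbitrary: u)
  case 0
  then show ?case using repunit_1[OF assms] by (simp add: repunit_value_def)
next
  case (Suc n)
  let ?A = "repunit a (Suc n)" and ?q = "u (Suc n)"
  have low: "0 \<le> repunit_value a (Suc n) u" "repunit_value a (Suc n) u < ?A"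
    using Suc.IH[OF canonical_tuples_truncate[OF Suc.prems]] unfolding repunit_value_upd by auto
  have A: "0 \<le> ?A" using repunit_nonneg[OF assms] .
  have "repunit_value a (Suc n) u + int ?q * ?A < a * ?A + 1"
  proof (cases "int ?q = a")
    case True
    then show ?thesis using canonical_tuples_top[OF Suc.prems] by simp
  next
    case False
    then have "int ?q + 1 \<le> a" using canonical_tuples_top(1)[OF Suc.prems] by simp
    then have "(int ?q + 1) * ?A \<le> a * ?A" using A by (rule mult_right_mono)
    then show ?thesis using low by (simp add: algebra_simps)
  qed
  then show ?case using low A assms by (simp add: repunit_value_Suc repunit_Suc[of a "Suc n"])
qed

lemma canonical_div_mod:
  assumes "a \<ge> 2" "u \<in> canonical_tuples a (Suc (Suc n))"
  shows "int (u (Suc n)) = repunit_value a (Suc (Suc n)) u div repunit a (Suc n)"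
    and "repunit_value a (Suc n) u = repunit_value a (Suc (Suc n)) u mod repunit a (Suc n)"
proof -
  have "0 \<le> repunit_value a (Suc n) u" "repunit_value a (Suc n) u < repunit a (Suc n)"
    using repunit_value_canonical_bounds[OF assms(1) canonical_tuples_truncate[OF assms(2)]]
    unfolding repunit_value_upd by auto
  then show "int (u (Suc n)) = repunit_value a (Suc (Suc n)) u div repunit a (Suc n)"
    "repunit_value a (Suc n) u = repunit_value a (Suc (Suc n)) u mod repunit a (Suc n)"
    by (auto simp: repunit_value_Suc)
qed

lemma canonical_unique:
  assumes "a \<ge> 2"
  shows "u \<in> canonical_tuples a (Suc n) \<Longrightarrow> v \<in> canonical_tuples a (Suc n) \<Longrightarrow>
         repunit_value a (Suc n) u = repunit_value a (Suc n) v \<Longrightarrow> u = v"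
proof (induction n arbitrary: u v)
  case 0
  then show ?case by (auto simp: canonical_tuples_def)
next
  case (Suc n)
  have "u (Suc n) = v (Suc n)"
    using canonical_div_mod(1)[OF assms] Suc.prems by (metis of_nat_eq_iff)
  moreover have "u(Suc n := 0) = v(Suc n := 0)"
    using canonical_div_mod(2)[OF assms] Suc.prems
    by (intro Suc.IH canonical_tuples_truncate) (simp_all only: repunit_value_upd)
  ultimately show ?case by (metis fun_upd_triv fun_upd_upd)
qed

text \<open>Greedy expansion: the top digit is the quotient by the top repunit, and the remainder is
  expanded recursively.\<close>

lemma canonical_exists:
  assumes "a \<ge> 2"
  shows "0 \<le> x \<Longrightarrow> x < repunit a (Suc n) \<Longrightarrow>
         \<exists>u \<in> canonical_tuples a (Suc n). x = repunit_value a (Suc n) u"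
proof (induction n arbitrary: x)
  case 0
  then show ?case
    using repunit_1[OF assms]
    by (intro bexI[of _ "\<lambda>_. 0"]) (auto simp: canonical_tuples_def repunit_value_def)
next
  case (Suc n)
  let ?A = "repunit a (Suc n)"
  have A: "?A > 0" using repunit_ge[OF assms, of "Suc n"] by simp
  have xle: "x \<le> a * ?A" using Suc.prems repunit_Suc[OF assms, of "Suc n"] by simp
  show ?case
  \<comment> \<open>Only this largest x has quotient a, and its remainder is 0. Every other x has
    top digit below a, which imposes nothing on the lower digits.\<close>
  proof (cases "x = a * ?A")
    case True
    let ?u = "(\<lambda>_. 0)(Suc n := nat a)"
    have "?u \<in> canonical_tuples a (Suc (Suc n))"
      using assms by (auto simp: canonical_tuples_def)
    moreover have "x = repunit_value a (Suc (Suc n)) ?u"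
      using True assms by (simp add: repunit_value_Suc repunit_value_upd) (simp add: repunit_value_def)
    ultimately show ?thesis by blast
  next
    case False
    have q: "x div ?A < a"
    proof (rule ccontr)
      assume "\<not> x div ?A < a"
      then have "a * ?A \<le> x div ?A * ?A" using A by (intro mult_right_mono) auto
      also have "\<dots> \<le> x"
        using div_mult_mod_eq[of x ?A] pos_mod_sign[OF A, of x] by linarith
      finally show False using xle False by simp
    qed
    have q0: "0 \<le> x div ?A" using Suc.prems(1) A by (simp add: pos_imp_zdiv_nonneg_iff)
    obtain v where v: "v \<in> canonical_tuples a (Suc n)" "x mod ?A = repunit_value a (Suc n) v"
      using Suc.IH[of "x mod ?A"] A by auto
    define c where "c = nat (x div ?A)"
    have c: "int c < a" "int c = x div ?A" using q q0 by (simp_all add: c_def)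
    let ?u = "v(Suc n := c)"
    have "?u \<in> canonical_tuples a (Suc (Suc n))"
      unfolding canonical_tuples_def
    proof (intro CollectI conjI allI ballI impI)
      fix i assume "i \<notin> {1..<Suc (Suc n)}"
      then show "?u i = 0" using v(1) by (auto simp: canonical_tuples_def)
    next
      fix i assume "i \<in> {1..<Suc (Suc n)}"
      then show "int (?u i) \<le> a"
        using v(1) c(1) by (cases "i = Suc n") (auto simp: canonical_tuples_def)
    next
      fix i k assume "i \<in> {1..<Suc (Suc n)}" "int (?u i) = a" "k \<in> {1..<i}"
      then have "i \<in> {1..<Suc n}" "int (v i) = a" "k \<noteq> Suc n"
        using c(1) by (auto split: if_splits)
      then show "?u k = 0"
        using v(1) \<open>k \<in> {1..<i}\<close> by (auto simp: canonical_tuples_def)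
    qed
    moreover have "x = repunit_value a (Suc (Suc n)) ?u"
      using div_mult_mod_eq[of x ?A]
      by (simp add: repunit_value_Suc repunit_value_upd v(2)[symmetric] c(2) add.commute)
    ultimately show ?thesis by blast
  qed
qed

lemma canonical_rep_div_mod:
  assumes "a \<ge> 2" "0 \<le> x" "x < repunit a (Suc (Suc n))"
  shows "int (canonical_rep a (Suc (Suc n)) x (Suc n)) = x div repunit a (Suc n)"
    and "repunit_value a (Suc n) (canonical_rep a (Suc (Suc n)) x) = x mod repunit a (Suc n)"
proof -
  let ?n = "Suc (Suc n)"
  have "\<exists>!u. u \<in> canonical_tuples a ?n \<and> x = repunit_value a ?n u"
    using canonical_exists[OF assms] canonical_unique[OF assms(1), of _ "Suc n"] by metis
  from theI'[OF this] have "canonical_rep a ?n x \<in> canonical_tuples a ?n"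
    "x = repunit_value a ?n (canonical_rep a ?n x)"
    by (simp_all add: canonical_rep_def)
  then show "int (canonical_rep a ?n x (Suc n)) = x div repunit a (Suc n)"
    "repunit_value a (Suc n) (canonical_rep a ?n x) = x mod repunit a (Suc n)"
    using canonical_div_mod[OF assms(1)] by metis+
qed

subsection \<open>The orbit semigroup\<close>

lemma affine_map_funpow:
  assumes "a \<ge> 2"
  shows "(affine_map a b ^^ i) m = m + ((a - 1) * m + b) * repunit a i"
proof (induction i)
  case (Suc i)
  then show ?case
    by (simp only: funpow.simps comp_apply affine_map_def repunit_Suc[OF assms])
      (simp add: algebra_simps)
qed simp

lemma orbit_semigroup_gen:
  assumes "a \<ge> 2"
  shows "m + ((a - 1) * m + b) * repunit a i \<in> orbit_semigroup a b m"
  unfolding orbit_semigroup_def affine_map_funpow[OF assms, symmetric]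
  by (rule submonoid_generated.gen) blast

text \<open>Here k counts generators. The generator m itself has index 0, so slack in the length of
  a sum corresponds to additional copies of m.\<close>

lemma orbit_semigroup_iff:
  assumes "a \<ge> 2"
  shows "s \<in> orbit_semigroup a b m \<longleftrightarrow>
         (\<exists>x k. repunit_sum a UNIV x k \<and> s = int k * m + ((a - 1) * m + b) * x)"
proof
  assume "s \<in> orbit_semigroup a b m"
  then show "\<exists>x k. repunit_sum a UNIV x k \<and> s = int k * m + ((a - 1) * m + b) * x"
    unfolding orbit_semigroup_def
  proof (induction rule: submonoid_generated.induct)
    case zero
    show ?case by (intro exI[of _ 0]) (simp add: repunit_sum.zero)
  next
    case (gen s)
    then obtain i where "s = m + ((a - 1) * m + b) * repunit a i"
      by (auto simp: affine_map_funpow[OF assms])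
    then show ?case using repunit_sum_multiple[of i UNIV a 1]
      by (intro exI[of _ "repunit a i"] exI[of _ 1]) simp
  next
    case (add s t)
    then obtain x k y k' where "repunit_sum a UNIV x k" "s = int k * m + ((a - 1) * m + b) * x"
      "repunit_sum a UNIV y k'" "t = int k' * m + ((a - 1) * m + b) * y" by blast
    then show ?case
      by (intro exI[of _ "x + y"] exI[of _ "k + k'"]) (auto intro: repunit_sum_add simp: distrib_left distrib_right)
  qed
next
  assume "\<exists>x k. repunit_sum a UNIV x k \<and> s = int k * m + ((a - 1) * m + b) * x"
  then obtain x k where "repunit_sum a UNIV x k" and s: "s = int k * m + ((a - 1) * m + b) * x"
    by blast
  then have "int k * m + ((a - 1) * m + b) * x \<in> orbit_semigroup a b m"
  proof (induction arbitrary: s rule: repunit_sum.induct)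
    \<comment> \<open>The empty sum with slack k stands for k copies of m.\<close>
    case (zero k)
    show ?case
    proof (induction k)
      case 0
      show ?case by (simp add: orbit_semigroup_def submonoid_generated.zero)
    next
      case (Suc k)
      then show ?case
        using orbit_semigroup_gen[OF assms, of m b 0]
        by (auto simp: orbit_semigroup_def algebra_simps dest: submonoid_generated.add)
    qed
  next
    case (step x k i)
    have "(int k * m + ((a - 1) * m + b) * x) + (m + ((a - 1) * m + b) * repunit a i)
        \<in> orbit_semigroup a b m"
      using step.IH[OF refl] orbit_semigroup_gen[OF assms, of m b i]
      unfolding orbit_semigroup_def by (rule submonoid_generated.add)
    then show ?case by (simp add: algebra_simps)
  qed
  then show "s \<in> orbit_semigroup a b m" using s by simp
qed

section \<open>Elements of the Apery set\<close>

text \<open>If subtracting m stayed in the semigroup, with data y and k, coprimality of m and d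
  would give y = x + m t and k = M - 1 - d t, where M is the minimal length of x. Negative t makes y
  negative, t = 0 yields a sum for x shorter than M, and positive t makes k too small.\<close>

lemma apery_set_orbit_semigroup:
  fixes a b m x :: int and n :: nat
  defines "d \<equiv> (a - 1) * m + b"
  assumes a: "a \<ge> 2" and m: "m > 1" and cop: "gcd b m = 1" and b: "b \<ge> - (a - 2) * m - 2"
    and n: "n \<ge> 2" "m \<le> repunit a n" and x: "0 \<le> x" "x < m"
  shows "d * x + int (min_length a n x) * m \<in> apery_set (orbit_semigroup a b m) m"
proof -
  let ?M = "min_length a n x"
  have d: "d \<ge> m - 2" using b by (simp add: d_def algebra_simps)
  then have d0: "d \<ge> 0" using m by simp
  have M: "repunit_sum a {..<n} x ?M" using repunit_sum_min_length a n x by simp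
  have Mx: "int ?M \<le> x" using min_length_le[OF repunit_sum_nat[OF a n(1) x(1)]] x by simp
  have "d * x + int ?M * m \<in> orbit_semigroup a b m"
    using repunit_sum_subset[OF M, of UNIV]
    by (auto simp: orbit_semigroup_iff[OF a] d_def intro!: exI[of _ x] exI[of _ ?M])
  moreover have "d * x + int ?M * m - m \<notin> orbit_semigroup a b m"
  proof
    assume "d * x + int ?M * m - m \<in> orbit_semigroup a b m"
    then obtain y k where y: "repunit_sum a UNIV y k" and
      eq: "d * x + int ?M * m - m = int k * m + d * y"
      unfolding orbit_semigroup_iff[OF a] d_def by blast
    have "d * (y - x) = (int ?M - 1 - int k) * m" using eq by (simp add: algebra_simps)
    then have "m dvd d * (y - x)" by simp
    \<comment> \<open>Modulo m, d is congruent to b.\<close>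
    moreover have "coprime m d"
      using cop gcd_add_mult[of m "a - 1" b]
      by (simp add: d_def coprime_iff_gcd_eq_1 gcd.commute)
    ultimately have "m dvd y - x" by (simp add: coprime_dvd_mult_right_iff)
    then obtain t where "y - x = m * t" unfolding dvd_def by blast
    then have t: "y = x + m * t" by simp
    have "(int ?M - 1 - int k) * m = (d * t) * m" using eq t by (simp add: algebra_simps)
    then have k: "int k = int ?M - 1 - d * t" using m by simp
    have "0 \<le> y" using repunit_sum_nonneg[OF y a] .
    have "t \<ge> 0"
    proof (rule ccontr)
      assume "\<not> t \<ge> 0"
      then have "m * t \<le> m * (-1)" using m by (intro mult_left_mono) auto
      then show False using t \<open>0 \<le> y\<close> x by simp
    qed
    show False
    proof (cases "t = 0")
      case True
      then have "repunit_sum a {..<n} x k"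
        using repunit_sum_restrict[OF y a] t x n by simp
      then show False using min_length_le[of a n x k] k True by simp
    next
      \<comment> \<open>A positive y needs k >= 1, whereas M <= x <= m - 1 and d >= m - 2 force k <=
        M - 1 - d <= 0.\<close>
      case False
      then have t1: "t \<ge> 1" using \<open>t \<ge> 0\<close> by simp
      then have "y > 0" using t x m by (simp add: add_nonneg_pos)
      then have "k \<ge> 1" by (auto elim: repunit_sum_pos_split[OF y])
      moreover have "d * 1 \<le> d * t" using t1 d0 by (intro mult_left_mono) auto
      ultimately show False using k d Mx x by simp
    qed
  qed
  ultimately show ?thesis by (simp add: apery_set_def)
qed

section \<open>Maximal elements and their top digits\<close>

theorem corollary5p9:
  fixes a b m d l :: int and n :: nat and S :: "int set"
    and u :: "int \<Rightarrow> nat \<Rightarrow> nat" and W r :: "int \<Rightarrow> int"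
  assumes "a \<ge> 2" and "m > 1" and "gcd b m = 1" and "b \<ge> - (a - 2) * m - 2"
    and "S = orbit_semigroup a b m"
    and "d = (a - 1) * m + b"
    and "n = (LEAST k. 0 < k \<and> repunit a k \<ge> m)"
    and "\<forall>x\<in>{0..m-1}. u x = canonical_rep a n x"
    and "\<forall>x\<in>{0..m-1}. W x = d * x + int (min_length a n x) * m"
    and "\<forall>x\<in>{0..m-1}. r x = (\<Sum>i\<in>{1..n-2}. int (u x i) * repunit a i)"
    and "l \<in> {0..m-1}"
    and "W l \<in> maximals (semigroup_le S) (apery_set S m)"
  shows "(u l (n-1) = u (m-1) (n-1) \<and> r l \<le> r (m-1)) \<noteq>
         (int (u l (n-1)) = int (u (m-1) (n-1)) - 1 \<and> r l \<ge> r (m-1) + 1)"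
proof -
  have a: "a \<ge> 2" and m: "m > 1" using assms by auto
  have ex: "0 < nat m \<and> m \<le> repunit a (nat m)" using repunit_ge[OF a, of "nat m"] m by simp
  have n0: "0 < n \<and> m \<le> repunit a n"
    unfolding assms(7) by (rule LeastI[of "\<lambda>k. 0 < k \<and> m \<le> repunit a k", OF ex])
  then have "n \<noteq> 1" using repunit_1[OF a] m by auto
  with n0 obtain j where n: "n = Suc (Suc j)"
    by (metis One_nat_def less_numeral_extra(3) not0_implies_Suc)
  let ?A = "repunit a (Suc j)"
  have A: "?A > 0" using repunit_ge[OF a, of "Suc j"] by simp
  have l: "0 \<le> l" "l \<le> m - 1" using assms(11) by auto
  have top: "int (u x (n - 1)) = x div ?A" and low: "r x = x mod ?A" if "x \<in> {0..m-1}" for x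
  proof -
    have x: "0 \<le> x" "x < repunit a (Suc (Suc j))" using that n0 n by auto
    have "u x = canonical_rep a n x" using assms(8) that by blast
    moreover have "r x = repunit_value a (Suc j) (u x)"
      using assms(10) that n by (simp add: repunit_value_def atLeastLessThanSuc_atLeastAtMost)
    ultimately show "int (u x (n - 1)) = x div ?A" "r x = x mod ?A"
      using canonical_rep_div_mod[OF a x] n by simp_all
  qed
  have far: "m - 1 < l + ?A"
  proof (rule ccontr)
    assume "\<not> m - 1 < l + ?A"
    then have l': "l + ?A \<in> {0..m-1}" using l A by simp
    have W: "W x = d * x + int (min_length a n x) * m" if "x \<in> {0..m-1}" for x
      using assms(9) that by blast
    have "n \<ge> 2" "m \<le> repunit a n" "0 \<le> l + ?A" "l + ?A < m"
      using n n0 l' by auto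
    then have "W (l + ?A) \<in> apery_set S m"
      unfolding W[OF l'] assms(5,6) by (rule apery_set_orbit_semigroup[OF assms(1-4)])
    moreover have diff: "W (l + ?A) - W l = m + d * ?A"
      unfolding W[OF l'] W[OF assms(11)] n min_length_add_top[OF a l(1)]
      by (simp add: algebra_simps)
    moreover have "m + d * ?A \<in> S"
      using orbit_semigroup_gen[OF a] assms(5,6) by simp
    ultimately have "W (l + ?A) = W l"
      using assms(12) by (auto simp: maximals_def semigroup_le_def)
    \<comment> \<open>Nonnegative d makes the generator positive, so the two values of
      \<open>W\<close> differ, against maximality.\<close>
    moreover have "d \<ge> 0" using assms(4,6) m by (simp add: algebra_simps)
    then have "m + d * ?A > 0" using A m by (simp add: add_pos_nonneg)
    ultimately show False using diff by simp
  qed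
  let ?q = "l div ?A" and ?Q = "(m - 1) div ?A" and ?r = "l mod ?A" and ?R = "(m - 1) mod ?A"
  have dl: "l = ?q * ?A + ?r" and dm: "m - 1 = ?Q * ?A + ?R" by (simp_all only: div_mult_mod_eq)
  have "?q \<le> ?Q" using l A by (intro zdiv_mono1) auto
  \<comment> \<open>By \<open>far\<close>, m - 1 is at most l plus one more top repunit, so the two
    top digits are equal or consecutive.\<close>
  moreover have "?Q \<le> ?q + 1"
    using zdiv_mono1[of "m - 1" "l + ?A" ?A] div_add_self2[of ?A l] far A by simp
  ultimately have "?q = ?Q \<or> ?q = ?Q - 1" by linarith
  \<comment> \<open>On truth values, inequality is exclusive or. With equal quotients, l <= m - 1
    compares the remainders; with consecutive ones, \<open>far\<close> does. The quotient conditions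
    exclude each other.\<close>
  then have "(?q = ?Q \<and> ?r \<le> ?R) \<noteq> (?q = ?Q - 1 \<and> ?r \<ge> ?R + 1)"
  proof
    assume "?q = ?Q"
    then have "?q * ?A = ?Q * ?A" by simp
    then have "?r \<le> ?R" using dl dm l by linarith
    then show ?thesis using \<open>?q = ?Q\<close> by simp
  next
    assume q: "?q = ?Q - 1"
    then have "?q * ?A + ?A = ?Q * ?A" by (simp only: left_diff_distrib)
    then have "?r \<ge> ?R + 1" using dl dm far by linarith
    then show ?thesis using q by simp
  qed
  note main = this
  have m1: "m - 1 \<in> {0..m-1}" using m by simp
  have eq: "u l (n - 1) = u (m - 1) (n - 1) \<longleftrightarrow> ?q = ?Q"
    unfolding top[OF assms(11), symmetric] top[OF m1, symmetric] by (rule of_nat_eq_iff[symmetric])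
  show ?thesis
    unfolding eq top[OF assms(11)] top[OF m1] low[OF assms(11)] low[OF m1] by (rule main)
qed

end
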